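(* Let $n>2$. There are exactly $\left(\left\lfloor \frac{n-1}{2}\right\rfloor !\right)\left(\left\lceil \frac{n-1}{2}\right\rceil !\right)$ distinct permutations $\gamma\in S_n$ with $\gamma(0)=0$ that are permutation bases for graceful expansions of members of $\mathbb{Z}_n^{\mathbb{Z}_n}$.
   Context: $\mathbb{Z}_n:=\{0,1,\dots,n-1\}$, $\mathbb{Z}_n^{\mathbb{Z}_n}$ is the set of maps $\mathbb{Z}_n\to\mathbb{Z}_n$, $S_n$ the symmetric group on $\mathbb{Z}_n$, composition is juxtaposition, $\varphi(i)=(n-1)-i$, $\varphi^{(0)}=\mathrm{id}$, $\varphi^{(1)}=\varphi$. A permutation $\gamma\in S_n$ is a permutation basis for a graceful expansion of $f\in\mathbb{Z}_n^{\mathbb{Z}_n}$ if there exist $\sigma\in S_n$ and a sign function $\mathfrak{s}(\gamma,\cdot):\mathbb{Z}_n\to\{-1,0,1\}$ such that for all $i\in\mathbb{Z}_n$ and $t\in\{0,1\}$, $f(i)=\sigma^{(-1)}\big(\varphi^{(t)}(\varphi^{(t)}(\sigma(i))+(-1)^t\mathfrak{s}(\gamma,\sigma(i))\gamma(\sigma(i)))\big)$; equivalently $|\varphi^{(t)}\sigma f\sigma^{(-1)}(j)-\varphi^{(t)}(j)|=\gamma(j)$ for all $j\in\mathbb{Z}_n$, $t\in\{0,1\}$. *)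

theory Defs
  imports Complex_Main "HOL-Library.FuncSet" "HOL-Combinatorics.Permutations"
begin

text \<open>The index set is a set of integers, so that differences are not truncated. Permutations
  in the sense of \<open>permutes\<close> are the identity off this set, so each element of \<open>S\<^sub>n\<close> is
  represented by exactly one function.\<close>

definition Zn :: "nat \<Rightarrow> int set" where
  "Zn n = {0..<int n}"

definition phi :: "nat \<Rightarrow> int \<Rightarrow> int" where
  "phi n i = (int n - 1) - i"

text \<open>The clause \<open>s j = 0 \<longrightarrow> g j = 0\<close> makes \<open>s\<close> a sign function for the displacement: without it,
  \<open>s = 0\<close> would make every permutation a basis for the identity map, and the definition would not
  agree with the characterisation by absolute differences proved below.
  No range condition on the argument of \<open>inv \<sigma>\<close> is needed when \<open>f\<close> maps \<open>Zn n\<close> to itself: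
  off \<open>Zn n\<close> the function \<open>inv \<sigma>\<close> is the identity, so the equation forces that argument
  into \<open>Zn n\<close>.\<close>

definition permutation_basis :: "nat \<Rightarrow> (int \<Rightarrow> int) \<Rightarrow> (int \<Rightarrow> int) \<Rightarrow> bool" where
  "permutation_basis n f g \<longleftrightarrow>
     g permutes Zn n \<and>
     (\<exists>\<sigma> s. \<sigma> permutes Zn n \<and>
        (\<forall>j\<in>Zn n. s j \<in> {-1, 0, 1} \<and> (s j = 0 \<longrightarrow> g j = 0)) \<and>
        (\<forall>i\<in>Zn n. \<forall>t\<in>{0, 1::nat}.
           f i = inv \<sigma> ((phi n ^^ t) ((phi n ^^ t) (\<sigma> i) + (-1) ^ t * s (\<sigma> i) * g (\<sigma> i)))))"

lemma permutation_basis_iff_abs: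
  assumes f: "f \<in> Zn n \<rightarrow> Zn n"
  shows "permutation_basis n f g \<longleftrightarrow>
     g permutes Zn n \<and>
     (\<exists>\<sigma>. \<sigma> permutes Zn n \<and>
        (\<forall>j\<in>Zn n. \<forall>t\<in>{0, 1::nat}.
           \<bar>(phi n ^^ t) (\<sigma> (f (inv \<sigma> j))) - (phi n ^^ t) j\<bar> = g j))"
proof -
  have 1: "\<exists>\<sigma>. \<sigma> permutes Zn n \<and> (\<forall>j\<in>Zn n. \<forall>t\<in>{0, 1::nat}.
           \<bar>(phi n ^^ t) (\<sigma> (f (inv \<sigma> j))) - (phi n ^^ t) j\<bar> = g j)"
    if pb: "permutation_basis n f g"
  proof -
    obtain \<sigma> s where g: "g permutes Zn n" and \<sigma>: "\<sigma> permutes Zn n"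
      and s: "\<forall>j\<in>Zn n. s j \<in> {-1, 0, 1} \<and> (s j = 0 \<longrightarrow> g j = 0)"
      and e: "\<forall>i\<in>Zn n. \<forall>t\<in>{0, 1::nat}.
           f i = inv \<sigma> ((phi n ^^ t) ((phi n ^^ t) (\<sigma> i) + (-1) ^ t * s (\<sigma> i) * g (\<sigma> i)))"
      using pb unfolding permutation_basis_def by blast
    have "\<bar>(phi n ^^ t) (\<sigma> (f (inv \<sigma> j))) - (phi n ^^ t) j\<bar> = g j"
      if j: "j \<in> Zn n" and t: "t \<in> {0, 1::nat}" for j t
    proof -
      have i: "inv \<sigma> j \<in> Zn n" using \<sigma> j by (simp add: permutes_in_image permutes_inv)
      have "f (inv \<sigma> j) = inv \<sigma> (j + s j * g j)"
        using e[rule_format, OF i, of 0] by (simp add: permutes_inverses(1)[OF \<sigma>])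
      then have "\<sigma> (f (inv \<sigma> j)) = j + s j * g j"
        by (simp add: permutes_inverses(1)[OF \<sigma>])
      moreover have "g j \<ge> 0" using permutes_in_image[OF g, of j] j by (simp add: Zn_def)
      ultimately show ?thesis using s[rule_format, OF j] t by (auto simp: phi_def)
    qed
    then show ?thesis using \<sigma> by blast
  qed
  have 2: "permutation_basis n f g"
    if g: "g permutes Zn n" and \<sigma>: "\<sigma> permutes Zn n"
      and e: "\<forall>j\<in>Zn n. \<forall>t\<in>{0, 1::nat}.
           \<bar>(phi n ^^ t) (\<sigma> (f (inv \<sigma> j))) - (phi n ^^ t) j\<bar> = g j" for \<sigma>
  proof -
    define s where "s j = sgn (\<sigma> (f (inv \<sigma> j)) - j)" for j
    have a: "\<bar>\<sigma> (f (inv \<sigma> j)) - j\<bar> = g j" if "j \<in> Zn n" for j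
      using e[rule_format, OF that, of 0] by simp
    have b: "s j * g j = \<sigma> (f (inv \<sigma> j)) - j" if "j \<in> Zn n" for j
      unfolding s_def a[OF that, symmetric] by (simp add: sgn_mult_abs)
    have "f i = inv \<sigma> ((phi n ^^ t) ((phi n ^^ t) (\<sigma> i) + (-1) ^ t * s (\<sigma> i) * g (\<sigma> i)))"
      if i: "i \<in> Zn n" and t: "t \<in> {0, 1::nat}" for i t
    proof -
      have "\<sigma> i \<in> Zn n" using i \<sigma> by (simp add: permutes_in_image)
      from b[OF this] have "s (\<sigma> i) * g (\<sigma> i) = \<sigma> (f i) - \<sigma> i"
        by (simp add: permutes_inverses(2)[OF \<sigma>])
      then show ?thesis using t
        by (auto simp: phi_def permutes_inverses(2)[OF \<sigma>])
    qed
    moreover have "s j \<in> {-1, 0, 1} \<and> (s j = 0 \<longrightarrow> g j = 0)" if "j \<in> Zn n" for j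
      using a[OF that] by (auto simp: s_def sgn_if)
    ultimately show ?thesis
      unfolding permutation_basis_def using g \<sigma> by blast
  qed
  show ?thesis using 1 2 unfolding permutation_basis_def by blast
qed

end

(* Conjugation does not affect the existence of f, so a permutation g is a basis exactly when
   g j <= max j (n - 1 - j) for every j. Adjoining the points one by one from the centre of
   the range outwards makes these bounds increase, so when the (i+1)-st point is adjoined, i of
   its admissible values are already taken and (n - i) div 2 remain, whatever the earlier choices. *)

theory Submission
  imports Defs
begin

lemma card_inj_PiE_insert:
  fixes B :: "'a \<Rightarrow> 'b set"
  assumes A: "finite A" "a \<notin> A" and B: "\<And>j. j \<in> A \<Longrightarrow> B j \<subseteq> B a" "finite (B a)"
  shows "card {g \<in> PiE (insert a A) B. inj_on g (insert a A)} =
         card {g \<in> PiE A B. inj_on g A} * (card (B a) - card A)"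
proof -
  define F where "F = {g \<in> PiE A B. inj_on g A}"
  have "finite F"
    unfolding F_def using A B by (auto intro!: finite_PiE intro: finite_subset)
  have rest: "card (B a - g ` A) = card (B a) - card A" if "g \<in> F" for g
  proof -
    have "g ` A \<subseteq> B a" "inj_on g A" using that B by (auto simp: F_def PiE_iff)
    then show ?thesis using A by (simp add: card_Diff_subset card_image)
  qed
  have "bij_betw (\<lambda>(g, y). g(a := y)) (SIGMA g:F. B a - g ` A)
          {g \<in> PiE (insert a A) B. inj_on g (insert a A)}"
  \<comment> \<open>The inverse splits off the value at \<open>a\<close> and resets it to
    \<open>undefined\<close>, the default that \<open>PiE A B\<close> demands off
    \<open>A\<close>.\<close>
  proof (rule bij_betw_byWitness[where f' = "\<lambda>h. (h(a := undefined), h a)"])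
    show "\<forall>p\<in>SIGMA g:F. B a - g ` A.
            (\<lambda>h. (h(a := undefined), h a)) ((\<lambda>(g, y). g(a := y)) p) = p"
      using A by (auto simp: F_def PiE_iff extensional_def)
    show "\<forall>h\<in>{g \<in> PiE (insert a A) B. inj_on g (insert a A)}.
            (\<lambda>(g, y). g(a := y)) (h(a := undefined), h a) = h"
      by auto
    show "(\<lambda>(g, y). g(a := y)) ` (SIGMA g:F. B a - g ` A)
            \<subseteq> {g \<in> PiE (insert a A) B. inj_on g (insert a A)}"
    proof clarify
      fix g y assume g: "g \<in> F" and y: "y \<in> B a" "y \<notin> g ` A"
      then have "g(a := y) \<in> PiE (insert a A) B"
        by (simp add: F_def PiE_fun_upd)
      moreover have "g(a := y) ` A = g ` A" "inj_on (g(a := y)) A"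
        using g y A by (auto simp: F_def intro: inj_on_fun_updI)
      ultimately show "g(a := y) \<in> PiE (insert a A) B \<and> inj_on (g(a := y)) (insert a A)"
        using y A by simp
    qed
    show "(\<lambda>h. (h(a := undefined), h a)) ` {g \<in> PiE (insert a A) B. inj_on g (insert a A)}
            \<subseteq> (SIGMA g:F. B a - g ` A)"
    proof (rule image_subsetI)
      fix h assume "h \<in> {g \<in> PiE (insert a A) B. inj_on g (insert a A)}"
      then have h: "h \<in> PiE (insert a A) B" "inj_on h (insert a A)" by auto
      have "h(a := undefined) \<in> PiE A B"
        using h A by (auto simp: PiE_iff extensional_def)
      moreover have "inj_on (h(a := undefined)) A \<longleftrightarrow> inj_on h A" "h(a := undefined) ` A = h ` A"
        using A by (auto intro!: inj_on_cong)
      moreover have "h a \<in> B a" "h a \<notin> h ` A" "inj_on h A"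
        using h A by auto
      ultimately show "(h(a := undefined), h a) \<in> (SIGMA g:F. B a - g ` A)"
        by (simp add: F_def)
    qed
  qed
  then have "card {g \<in> PiE (insert a A) B. inj_on g (insert a A)} =
      (\<Sum>g\<in>F. card (B a - g ` A))"
    using \<open>finite F\<close> B by (subst card_SigmaI[symmetric]) (auto dest: bij_betw_same_card)
  also have "\<dots> = card F * (card (B a) - card A)"
    using rest by simp
  finally show ?thesis by (simp add: F_def)
qed

text \<open>\<open>D k\<close> consists of the \<open>k\<close> points nearest the centre of
  \<open>Zn n\<close>, with ties resolved to the right so that 0 comes last and
  \<open>D (n - 1)\<close> omits only 0. The sets \<open>B j\<close> start at 1 because the value 0
  is reserved for the fixed point 0.\<close>

lemma card_centred_inj:
  fixes n k :: nat
  assumes "k < n"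
  defines "D \<equiv> \<lambda>k. {int ((n - k + 1) div 2)..<int ((n - k + 1) div 2 + k)}"
    and "B \<equiv> \<lambda>j. {1..max j (int n - 1 - j)}"
  shows "card {g \<in> PiE (D k) B. inj_on g (D k)} = (\<Prod>i<k. (n - i) div 2)"
  using \<open>k < n\<close>
proof (induction k)
  case 0
  then show ?case by (simp add: D_def)
next
  case (Suc k)
  define c where "c = (n - k) div 2"
  have step: "card {g \<in> PiE (D (Suc k)) B. inj_on g (D (Suc k))} =
      card {g \<in> PiE (D k) B. inj_on g (D k)} * c"
    if "D (Suc k) = insert a (D k)" "a \<notin> D k" "\<And>j. j \<in> D k \<Longrightarrow> B j \<subseteq> B a" "card (B a) = c + k" for a
  proof -
    have "finite (D k)" "finite (B a)" "card (D k) = k" by (simp_all add: D_def B_def)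
    with card_inj_PiE_insert[of "D k" a B] that show ?thesis by simp
  qed
  have "card {g \<in> PiE (D (Suc k)) B. inj_on g (D (Suc k))} =
      card {g \<in> PiE (D k) B. inj_on g (D k)} * c"
  proof (cases "even (n - k)")
    case True
    then have n: "n = 2 * c + k" using Suc.prems by (simp add: c_def)
    have "c > 0" using n Suc.prems True by (auto intro!: gr0I)
    have "(n - k + 1) div 2 = c" "(n - Suc k + 1) div 2 = c"
      using n \<open>c > 0\<close> by auto
    then have D: "D k = {int c..<int (c + k)}" "D (Suc k) = {int c..<int (c + Suc k)}"
      unfolding D_def by simp_all
    show ?thesis
      \<comment> \<open>The block is symmetric under \<open>phi n\<close> and grows to the right.
        The mirror image of the new point is \<open>c - 1\<close>, so its bound is the point
        \<open>c + k\<close> itself.\<close>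
      by (rule step[of "int (c + k)"]) (use n in \<open>auto simp: D B_def max_def\<close>)
  next
    case False
    then have n: "n = 2 * c + 1 + k" using Suc.prems unfolding c_def by presburger
    have "(n - k + 1) div 2 = c + 1" "(n - Suc k + 1) div 2 = c"
      using n by auto
    then have D: "D k = {int (c + 1)..<int (c + 1 + k)}" "D (Suc k) = {int c..<int (c + Suc k)}"
      unfolding D_def by simp_all
    show ?thesis
      \<comment> \<open>The block leans to the right by one point, and \<open>c\<close> restores its
        symmetry. Here the bound is the mirror image \<open>n - 1 - c = c + k\<close>, which the
        last point of the block already attains.\<close>
      by (rule step[of "int c"]) (use n in \<open>auto simp: D B_def max_def\<close>)
  qed
  then show ?case using Suc by (simp add: c_def)
qed

text \<open>The factors are the halves, rounded down, of 2, ..., \<open>m + 1\<close>: the even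
  numbers contribute one factorial, the odd ones the other.\<close>

lemma prod_half_fact: "(\<Prod>i<m. (m + 1 - i) div 2) = fact (m div 2) * (fact ((m + 1) div 2) :: nat)"
proof (induction m)
  case 0
  show ?case by simp
next
  case (Suc m)
  have "(\<Prod>i<Suc m. (Suc m + 1 - i) div 2) = Suc (m div 2) * (\<Prod>i<m. (m + 1 - i) div 2)"
    by (subst prod.lessThan_Suc_shift) simp
  \<comment> \<open>The leading factor enlarges the smaller-index factorial
    \<open>fact (m div 2)\<close>, and the two factorials exchange roles.\<close>
  also have "\<dots> = fact ((m + 1) div 2) * (fact (Suc (m div 2)))"
    using Suc by (simp add: algebra_simps)
  finally show ?case by simp
qed

text \<open>A point at distance \<open>g j\<close> from \<open>j\<close> exists in
  \<open>Zn n\<close> exactly when \<open>g j\<close> does not exceed the distance from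
  \<open>j\<close> to the farther end.\<close>

lemma ex_permutation_basis_iff:
  assumes g: "g permutes Zn n"
  shows "(\<exists>f \<in> Zn n \<rightarrow>\<^sub>E Zn n. permutation_basis n f g) \<longleftrightarrow>
         (\<forall>j\<in>Zn n. g j \<le> max j (int n - 1 - j))"
proof
  assume "\<exists>f \<in> Zn n \<rightarrow>\<^sub>E Zn n. permutation_basis n f g"
  then obtain f where f: "f \<in> Zn n \<rightarrow> Zn n" and "permutation_basis n f g"
    by auto
  then obtain \<sigma> where \<sigma>: "\<sigma> permutes Zn n"
    and e: "\<forall>j\<in>Zn n. \<forall>t\<in>{0, 1::nat}.
           \<bar>(phi n ^^ t) (\<sigma> (f (inv \<sigma> j))) - (phi n ^^ t) j\<bar> = g j"
    using permutation_basis_iff_abs[OF f] by blast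
  show "\<forall>j\<in>Zn n. g j \<le> max j (int n - 1 - j)"
  proof
    fix j assume j: "j \<in> Zn n"
    have "\<sigma> (f (inv \<sigma> j)) \<in> Zn n"
      using f j \<sigma> by (auto simp: permutes_in_image permutes_inv)
    moreover have "\<bar>\<sigma> (f (inv \<sigma> j)) - j\<bar> = g j" using e[rule_format, OF j, of 0] by simp
    ultimately show "g j \<le> max j (int n - 1 - j)" by (auto simp: Zn_def)
  qed
next
  assume le: "\<forall>j\<in>Zn n. g j \<le> max j (int n - 1 - j)"
  \<comment> \<open>Move left when there is room. Otherwise \<open>g j > j\<close>, so the bound
    forces \<open>g j \<le> n - 1 - j\<close> and there is room on the right.\<close>
  define f where "f = restrict (\<lambda>j. if g j \<le> j then j - g j else j + g j) (Zn n)"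
  have pos: "0 \<le> g j" if "j \<in> Zn n" for j
    using permutes_in_image[OF g, of j] that by (simp add: Zn_def)
  have f: "f \<in> Zn n \<rightarrow>\<^sub>E Zn n"
    using pos le by (fastforce simp: f_def Zn_def)
  \<comment> \<open>The witness for \<sigma> is the identity. The reflection \<open>phi n\<close>
    preserves distances, so both values of \<open>t\<close> give the same condition.\<close>
  have "\<bar>(phi n ^^ t) (id (f (inv id j))) - (phi n ^^ t) j\<bar> = g j"
    if "j \<in> Zn n" "t \<in> {0, 1::nat}" for j t
    using that pos[of j] by (auto simp: f_def phi_def)
  then have "permutation_basis n f g"
    using permutation_basis_iff_abs[of f n g] f g permutes_id by blast
  with f show "\<exists>f \<in> Zn n \<rightarrow>\<^sub>E Zn n. permutation_basis n f g" by blast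
qed

text \<open>This reconciles two defaults off \<open>A\<close>: the identity for permutations and
  \<open>undefined\<close> for \<open>PiE\<close>. An injective self-map of the finite set
  \<open>A\<close> is onto, hence a permutation.\<close>

lemma card_bounded_permutes:
  fixes A :: "'a set"
  assumes "finite A" "\<And>j. j \<in> A \<Longrightarrow> B j \<subseteq> A"
  shows "card {g. g permutes A \<and> (\<forall>j\<in>A. g j \<in> B j)} = card {g \<in> PiE A B. inj_on g A}"
proof (rule bij_betw_same_card)
  show "bij_betw (\<lambda>g. restrict g A) {g. g permutes A \<and> (\<forall>j\<in>A. g j \<in> B j)}
          {g \<in> PiE A B. inj_on g A}"
  proof (rule bij_betw_byWitness[where f' = "\<lambda>h x. if x \<in> A then h x else x"])
    show "(\<lambda>h x. if x \<in> A then h x else x) ` {g \<in> PiE A B. inj_on g A}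
            \<subseteq> {g. g permutes A \<and> (\<forall>j\<in>A. g j \<in> B j)}"
    proof clarsimp
      fix h assume h: "h \<in> PiE A B" "inj_on h A"
      then have "h ` A \<subseteq> A" using assms by (auto simp: PiE_iff)
      then have "bij_betw h A A"
        using h assms by (simp add: bij_betw_def endo_inj_surj)
      then have "bij_betw (\<lambda>x. if x \<in> A then h x else x) A A"
        by (simp cong: bij_betw_cong)
      then have "(\<lambda>x. if x \<in> A then h x else x) permutes A"
        by (rule bij_imp_permutes) simp
      then show "(\<lambda>x. if x \<in> A then h x else x) permutes A \<and> (\<forall>j\<in>A. h j \<in> B j)"
        using h by (auto simp: PiE_iff)
    qed
  next
    show "\<forall>g\<in>{g. g permutes A \<and> (\<forall>j\<in>A. g j \<in> B j)}.
            (\<lambda>x. if x \<in> A then restrict g A x else x) = g"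
      by (auto simp: fun_eq_iff permutes_not_in)
    show "\<forall>h\<in>{g \<in> PiE A B. inj_on g A}. restrict (\<lambda>x. if x \<in> A then h x else x) A = h"
      by (auto simp: fun_eq_iff PiE_iff extensional_def)
    show "(\<lambda>g. restrict g A) ` {g. g permutes A \<and> (\<forall>j\<in>A. g j \<in> B j)}
            \<subseteq> {g \<in> PiE A B. inj_on g A}"
      by (auto simp: inj_on_restrict_eq intro: permutes_inj_on)
  qed
qed

theorem theorem4:
  fixes n :: nat
  assumes "n > 2"
  shows "card {\<gamma>. \<gamma> permutes Zn n \<and> \<gamma> 0 = 0 \<and>
                  (\<exists>f \<in> Zn n \<rightarrow>\<^sub>E Zn n. permutation_basis n f \<gamma>)} =
         fact (nat \<lfloor>(real n - 1) / 2\<rfloor>) * fact (nat \<lceil>(real n - 1) / 2\<rceil>)"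
proof -
  define A where "A = {1..<int n}"
  define B where "B j = {1..max j (int n - 1 - j)}" for j
  obtain m where n: "n = m + 1" using assms by (cases n) auto
  have Zn: "Zn n = insert 0 A" using assms by (auto simp: Zn_def A_def)
  have perm: "\<gamma> permutes Zn n \<and> \<gamma> 0 = 0 \<longleftrightarrow> \<gamma> permutes A" for \<gamma>
  proof
    assume "\<gamma> permutes Zn n \<and> \<gamma> 0 = 0"
    then show "\<gamma> permutes A" by (auto simp: Zn intro: permutes_superset)
  next
    assume "\<gamma> permutes A"
    then show "\<gamma> permutes Zn n \<and> \<gamma> 0 = 0"
      by (auto simp: Zn A_def intro: permutes_subset permutes_not_in)
  qed
  \<comment> \<open>At 0 the bound holds because 0 is fixed; elsewhere the values are positive,
    which supplies the lower end of \<open>B j\<close>.\<close>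
  have bound: "(\<forall>j\<in>Zn n. \<gamma> j \<le> max j (int n - 1 - j)) \<longleftrightarrow> (\<forall>j\<in>A. \<gamma> j \<in> B j)"
    if "\<gamma> permutes A" for \<gamma>
  proof -
    have "\<gamma> 0 = 0" using that perm by blast
    moreover have "1 \<le> \<gamma> j" if "j \<in> A" for j
      using permutes_in_image[OF \<open>\<gamma> permutes A\<close>, of j] that by (simp add: A_def)
    ultimately show ?thesis using assms by (auto simp: Zn B_def)
  qed
  have "{\<gamma>. \<gamma> permutes Zn n \<and> \<gamma> 0 = 0 \<and> (\<exists>f \<in> Zn n \<rightarrow>\<^sub>E Zn n. permutation_basis n f \<gamma>)} =
      {\<gamma>. \<gamma> permutes A \<and> (\<forall>j\<in>A. \<gamma> j \<in> B j)}"
  proof (rule Collect_cong)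
    fix \<gamma>
    show "(\<gamma> permutes Zn n \<and> \<gamma> 0 = 0 \<and>
          (\<exists>f \<in> Zn n \<rightarrow>\<^sub>E Zn n. permutation_basis n f \<gamma>)) \<longleftrightarrow>
        \<gamma> permutes A \<and> (\<forall>j\<in>A. \<gamma> j \<in> B j)"
      using perm[of \<gamma>] bound[of \<gamma>] ex_permutation_basis_iff[of \<gamma> n] by argo
  qed
  moreover have "card {\<gamma>. \<gamma> permutes A \<and> (\<forall>j\<in>A. \<gamma> j \<in> B j)} = card {g \<in> PiE A B. inj_on g A}"
    by (rule card_bounded_permutes) (auto simp: A_def B_def)
  \<comment> \<open>\<open>A\<close> is the central block with \<open>m = n - 1\<close> points: its
    left end is \<open>(n - m + 1) div 2 = 1\<close>.\<close>
  moreover have "card {g \<in> PiE A B. inj_on g A} = (\<Prod>i<m. (n - i) div 2)"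
    using card_centred_inj[of m n] by (simp add: n A_def B_def[abs_def] add.commute)
  moreover have "(\<Prod>i<m. (n - i) div 2) = fact (m div 2) * fact ((m + 1) div 2)"
    using prod_half_fact[of m] by (simp add: n)
  moreover have "nat \<lfloor>(real n - 1) / 2\<rfloor> = m div 2"
    by (simp add: n floor_divide_of_nat_eq[of m 2, simplified])
  moreover have "nat \<lceil>(real n - 1) / 2\<rceil> = (m + 1) div 2"
  proof -
    have "\<lceil>real m / 2\<rceil> = int ((m + 1) div 2)"
      by (cases "even m") (auto elim!: evenE oddE intro!: ceiling_unique)
    then show ?thesis by (simp add: n)
  qed
  ultimately show ?thesis by simp
qed

end
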